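(* Let $(Q,\cdot)$ be a quasigroup. 1. If $(Q,\cdot)$ is an LIP-quasigroup, then ${}_2\Theta^A_r={}_3\Theta^A_r$ and these equivalences are normal from the left. 2. If $(Q,\cdot)$ is an RIP-quasigroup, then ${}_1\Theta^A_l={}_3\Theta^A_l$ and these equivalences are normal from the right. 3. If $(Q,\cdot)$ is a TS-quasigroup, then ${}_1\Theta^A_l={}_3\Theta^A_l={}_2\Theta^A_r={}_3\Theta^A_r={}_1\Theta^A_m={}_2\Theta^A_m$ and all these equivalences are normal congruences.
   Context: A quasigroup $(Q,\cdot)$ is a non-empty set $Q$ with a binary operation such that for all $a,b\in Q$ the equations $x\cdot a=b$ and $a\cdot y=b$ each have a unique solution. It is an LIP-quasigroup if there is a permutation $\lambda$ of $Q$ with $\lambda x\cdot(x\cdot y)=y$ for all $x,y$; an RIP-quasigroup if there is a permutation $\rho$ of $Q$ with $(x\cdot y)\cdot\rho y=x$ for all $x,y$; a TS-quasigroup if $x\cdot y=y\cdot x$ and $x\cdot(x\cdot y)=y$ for all $x,y$. $\varepsilon$ is the identity permutation. An autotopy is a triple $(\alpha,\beta,\gamma)$ of permutations of $Q$ with $\alpha x\cdot\beta y=\gamma(x\cdot y)$ for all $x,y$. $N^A_l,N^A_r,N^A_m$ are the groups of autotopies of the forms $(\alpha,\varepsilon,\gamma)$, $(\varepsilon,\beta,\gamma)$, $(\alpha,\beta,\varepsilon)$ respectively; ${}_iN^A_l$, ${}_iN^A_r$, ${}_iN^A_m$ is the group of $i$-th components of their elements. ${}_i\Theta^A_l$, ${}_i\Theta^A_r$,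 ${}_i\Theta^A_m$ is the equivalence on $Q$ whose classes are the orbits of the group ${}_iN^A_l$, ${}_iN^A_r$, ${}_iN^A_m$ respectively. An equivalence $\theta$ is normal from the left if $x\,\theta\,y\Leftrightarrow(z\cdot x)\,\theta\,(z\cdot y)$ for all $x,y,z$; normal from the right if $x\,\theta\,y\Leftrightarrow(x\cdot z)\,\theta\,(y\cdot z)$ for all $x,y,z$; a normal congruence if both hold. *)

theory Defs
  imports "HOL-Algebra.Algebra"
begin

section \<open>Quasigroups\<close>

locale quasigroup =
  fixes Q :: "'a set" and f :: "'a \<Rightarrow> 'a \<Rightarrow> 'a"  (infixl \<open>\<cdot>\<close> 70)
  assumes nonempty: "Q \<noteq> {}"
    and closed: "\<lbrakk>x \<in> Q; y \<in> Q\<rbrakk> \<Longrightarrow> x \<cdot> y \<in> Q"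
    and left_div: "\<lbrakk>a \<in> Q; b \<in> Q\<rbrakk> \<Longrightarrow> \<exists>!x. x \<in> Q \<and> x \<cdot> a = b"
    and right_div: "\<lbrakk>a \<in> Q; b \<in> Q\<rbrakk> \<Longrightarrow> \<exists>!y. y \<in> Q \<and> a \<cdot> y = b"

locale LIP_quasigroup = quasigroup +
  assumes LIP: "\<exists>lam \<in> Bij Q. \<forall>x\<in>Q. \<forall>y\<in>Q. lam x \<cdot> (x \<cdot> y) = y"

locale RIP_quasigroup = quasigroup +
  assumes RIP: "\<exists>rho \<in> Bij Q. \<forall>x\<in>Q. \<forall>y\<in>Q. (x \<cdot> y) \<cdot> rho y = x"

locale TS_quasigroup = quasigroup +
  assumes comm: "\<lbrakk>x \<in> Q; y \<in> Q\<rbrakk> \<Longrightarrow> x \<cdot> y = y \<cdot> x"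
    and TS: "\<lbrakk>x \<in> Q; y \<in> Q\<rbrakk> \<Longrightarrow> x \<cdot> (x \<cdot> y) = y"

section \<open>Autotopies\<close>

definition autotopies :: "'a set \<Rightarrow> ('a \<Rightarrow> 'a \<Rightarrow> 'a) \<Rightarrow> (('a \<Rightarrow> 'a) \<times> ('a \<Rightarrow> 'a) \<times> ('a \<Rightarrow> 'a)) set"
  where "autotopies Q f = {(\<alpha>, \<beta>, \<gamma>). \<alpha> \<in> Bij Q \<and> \<beta> \<in> Bij Q \<and> \<gamma> \<in> Bij Q \<and>
           (\<forall>x\<in>Q. \<forall>y\<in>Q. f (\<alpha> x) (\<beta> y) = \<gamma> (f x y))}"

definition NA_l where "NA_l Q f = {(\<alpha>, \<beta>, \<gamma>) \<in> autotopies Q f. \<beta> = \<one>\<^bsub>BijGroup Q\<^esub>}"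
definition NA_r where "NA_r Q f = {(\<alpha>, \<beta>, \<gamma>) \<in> autotopies Q f. \<alpha> = \<one>\<^bsub>BijGroup Q\<^esub>}"
definition NA_m where "NA_m Q f = {(\<alpha>, \<beta>, \<gamma>) \<in> autotopies Q f. \<gamma> = \<one>\<^bsub>BijGroup Q\<^esub>}"

definition comp1 where "comp1 N = (\<lambda>(\<alpha>, \<beta>, \<gamma>). \<alpha>) ` N"
definition comp2 where "comp2 N = (\<lambda>(\<alpha>, \<beta>, \<gamma>). \<beta>) ` N"
definition comp3 where "comp3 N = (\<lambda>(\<alpha>, \<beta>, \<gamma>). \<gamma>) ` N"

text \<open>For a permutation group \<open>H\<close> on \<open>Q\<close> (a subgroup of \<open>BijGroup Q\<close>), the equivalence
  whose classes are the orbits of \<open>H\<close>; see \<open>equiv_orbit_rel\<close> and \<open>quotient_orbit_rel\<close> below.\<close>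

definition orbit_rel :: "'a set \<Rightarrow> ('a \<Rightarrow> 'a) set \<Rightarrow> 'a rel"
  where "orbit_rel Q H =
    {(x, y). \<exists>B \<in> orbits ((BijGroup Q)\<lparr>carrier := H\<rparr>) Q (\<lambda>\<sigma>. \<sigma>). x \<in> B \<and> y \<in> B}"

definition Theta1_l where "Theta1_l Q f = orbit_rel Q (comp1 (NA_l Q f))"
definition Theta3_l where "Theta3_l Q f = orbit_rel Q (comp3 (NA_l Q f))"
definition Theta2_r where "Theta2_r Q f = orbit_rel Q (comp2 (NA_r Q f))"
definition Theta3_r where "Theta3_r Q f = orbit_rel Q (comp3 (NA_r Q f))"
definition Theta1_m where "Theta1_m Q f = orbit_rel Q (comp1 (NA_m Q f))"
definition Theta2_m where "Theta2_m Q f = orbit_rel Q (comp2 (NA_m Q f))"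

section \<open>Normality\<close>

definition normal_from_left :: "'a set \<Rightarrow> ('a \<Rightarrow> 'a \<Rightarrow> 'a) \<Rightarrow> 'a rel \<Rightarrow> bool"
  where "normal_from_left Q f \<theta> \<longleftrightarrow> equiv Q \<theta> \<and>
    (\<forall>x\<in>Q. \<forall>y\<in>Q. \<forall>z\<in>Q. (x, y) \<in> \<theta> \<longleftrightarrow> (f z x, f z y) \<in> \<theta>)"

definition normal_from_right :: "'a set \<Rightarrow> ('a \<Rightarrow> 'a \<Rightarrow> 'a) \<Rightarrow> 'a rel \<Rightarrow> bool"
  where "normal_from_right Q f \<theta> \<longleftrightarrow> equiv Q \<theta> \<and>
    (\<forall>x\<in>Q. \<forall>y\<in>Q. \<forall>z\<in>Q. (x, y) \<in> \<theta> \<longleftrightarrow> (f x z, f y z) \<in> \<theta>)"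

definition normal_congruence :: "'a set \<Rightarrow> ('a \<Rightarrow> 'a \<Rightarrow> 'a) \<Rightarrow> 'a rel \<Rightarrow> bool"
  where "normal_congruence Q f \<theta> \<longleftrightarrow> normal_from_left Q f \<theta> \<and> normal_from_right Q f \<theta>"

section \<open>Well-definedness\<close>

lemma BijGroup_simps:
  "carrier (BijGroup Q) = Bij Q"
  "\<one>\<^bsub>BijGroup Q\<^esub> = (\<lambda>x\<in>Q. x)"
  "\<lbrakk>g \<in> Bij Q; h \<in> Bij Q\<rbrakk> \<Longrightarrow> g \<otimes>\<^bsub>BijGroup Q\<^esub> h = compose Q g h"
  by (simp_all add: BijGroup_def)

lemma group_action_BijGroup_subgroup:
  assumes "subgroup H (BijGroup Q)"
  shows "group_action ((BijGroup Q)\<lparr>carrier := H\<rparr>) Q (\<lambda>\<sigma>. \<sigma>)"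
proof -
  interpret B: group "BijGroup Q" by (rule group_BijGroup)
  have "(\<lambda>\<sigma>. \<sigma>) \<in> hom ((BijGroup Q)\<lparr>carrier := H\<rparr>) (BijGroup Q)"
    using subgroup.subset[OF assms] by (auto simp: hom_def)
  then show ?thesis
    using B.subgroup_imp_group[OF assms] group_BijGroup[of Q]
    by (simp add: group_action_def group_hom_def group_hom_axioms_def)
qed

lemma
  assumes "subgroup H (BijGroup Q)"
  shows equiv_orbit_rel: "equiv Q (orbit_rel Q H)"
    and quotient_orbit_rel: "Q // orbit_rel Q H = orbits ((BijGroup Q)\<lparr>carrier := H\<rparr>) Q (\<lambda>\<sigma>. \<sigma>)"
proof -
  let ?G = "(BijGroup Q)\<lparr>carrier := H\<rparr>" let ?\<phi> = "\<lambda>\<sigma>::'a \<Rightarrow> 'a. \<sigma>"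
  interpret A: group_action ?G Q ?\<phi>
    by (rule group_action_BijGroup_subgroup[OF assms])
  have cov: "\<Union>(orbits ?G Q ?\<phi>) = Q" by (rule A.orbits_coverture)
  note disj = A.disjoint_union
  show eq: "equiv Q (orbit_rel Q H)"
  proof (rule equivI)
    show "orbit_rel Q H \<subseteq> Q \<times> Q" using cov by (auto simp: orbit_rel_def)
    show "refl_on Q (orbit_rel Q H)" using cov by (auto simp: orbit_rel_def refl_on_def)
    show "sym (orbit_rel Q H)" by (auto simp: orbit_rel_def sym_def)
    show "trans (orbit_rel Q H)" unfolding orbit_rel_def trans_def using disj by blast
  qed
  have cls: "orbit_rel Q H `` {x} = B" if "B \<in> orbits ?G Q ?\<phi>" "x \<in> B" for x B
    using that disj by (auto simp: orbit_rel_def)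
  have "B \<noteq> {}" if "B \<in> orbits ?G Q ?\<phi>" for B
    using that A.orbit_refl by (auto simp: orbits_def)
  then show "Q // orbit_rel Q H = orbits ?G Q ?\<phi>"
    using cov cls by (fastforce simp: quotient_def)
qed

context quasigroup
begin

abbreviation (input) "\<B> \<equiv> BijGroup Q \<times>\<times> BijGroup Q \<times>\<times> BijGroup Q"

lemma group_triples: "group \<B>"
  by (intro DirProd_group group_BijGroup)

lemma subgroup_autotopies: "subgroup (autotopies Q f) \<B>"
proof (rule group.subgroupI[OF group_triples])
  interpret B: group "BijGroup Q" by (rule group_BijGroup)
  show "autotopies Q f \<subseteq> carrier \<B>"
    by (auto simp: autotopies_def BijGroup_simps)
  have "(\<one>\<^bsub>BijGroup Q\<^esub>, \<one>\<^bsub>BijGroup Q\<^esub>, \<one>\<^bsub>BijGroup Q\<^esub>) \<in> autotopies Q f"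
    by (auto simp: autotopies_def BijGroup_simps id_Bij closed)
  then show "autotopies Q f \<noteq> {}" by blast
next
  fix s t assume "s \<in> autotopies Q f" "t \<in> autotopies Q f"
  then show "s \<otimes>\<^bsub>\<B>\<^esub> t \<in> autotopies Q f"
    using Bij_imp_funcset[of _ Q]
    by (auto simp: autotopies_def BijGroup_simps compose_Bij compose_eq closed Pi_iff)
next
  fix s assume "s \<in> autotopies Q f"
  then obtain \<alpha> \<beta> \<gamma> where s: "s = (\<alpha>, \<beta>, \<gamma>)" "\<alpha> \<in> Bij Q" "\<beta> \<in> Bij Q" "\<gamma> \<in> Bij Q"
    and atp: "\<And>x y. \<lbrakk>x \<in> Q; y \<in> Q\<rbrakk> \<Longrightarrow> \<alpha> x \<cdot> \<beta> y = \<gamma> (x \<cdot> y)"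
    by (auto simp: autotopies_def)
  let ?a = "inv_into Q \<alpha>" and ?b = "inv_into Q \<beta>" and ?c = "inv_into Q \<gamma>"
  have "?a x \<cdot> ?b y = ?c (x \<cdot> y)" if xy: "x \<in> Q" "y \<in> Q" for x y
  proof -
    have im: "\<alpha> ` Q = Q" "\<beta> ` Q = Q" and inj: "inj_on \<gamma> Q"
      using s by (auto simp: Bij_def bij_betw_def)
    have q: "?a x \<in> Q" "?b y \<in> Q" using s xy by (auto intro: Bij_inv_into_mem)
    have "\<gamma> (?a x \<cdot> ?b y) = x \<cdot> y"
      using atp[OF q] im xy by (simp add: f_inv_into_f)
    then show ?thesis using inv_into_f_f[OF inj closed[OF q]] by simp
  qed
  then show "inv\<^bsub>\<B>\<^esub> s \<in> autotopies Q f"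
    using s by (auto simp: autotopies_def inv_DirProd group_BijGroup DirProd_group
        BijGroup_simps inv_BijGroup restrict_inv_into_Bij closed)
qed

lemma
  shows subgroup_NA_l: "subgroup (NA_l Q f) \<B>"
    and subgroup_NA_r: "subgroup (NA_r Q f) \<B>"
    and subgroup_NA_m: "subgroup (NA_m Q f) \<B>"
proof -
  interpret B: group "BijGroup Q" by (rule group_BijGroup)
  interpret T: group \<B> by (rule group_triples)
  let ?C = "carrier (BijGroup Q)" and ?I = "{\<one>\<^bsub>BijGroup Q\<^esub>}"
  have C: "subgroup ?C (BijGroup Q)" and I: "subgroup ?I (BijGroup Q)"
    by (rule B.subgroup_self, rule B.triv_subgroup)
  note P = DirProd_subgroups DirProd_group group_BijGroup C I
  have "NA_l Q f = autotopies Q f \<inter> (?C \<times> ?I \<times> ?C)"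
    "NA_r Q f = autotopies Q f \<inter> (?I \<times> ?C \<times> ?C)"
    "NA_m Q f = autotopies Q f \<inter> (?C \<times> ?C \<times> ?I)"
    by (auto simp: NA_l_def NA_r_def NA_m_def autotopies_def BijGroup_simps)
  then show "subgroup (NA_l Q f) \<B>" "subgroup (NA_r Q f) \<B>" "subgroup (NA_m Q f) \<B>"
    by (auto intro!: T.subgroups_Inter_pair subgroup_autotopies P)
qed

lemma
  assumes "subgroup N \<B>"
  shows subgroup_comp1: "subgroup (comp1 N) (BijGroup Q)"
    and subgroup_comp2: "subgroup (comp2 N) (BijGroup Q)"
    and subgroup_comp3: "subgroup (comp3 N) (BijGroup Q)"
proof -
  have "group_hom \<B> (BijGroup Q) (\<lambda>(\<alpha>, \<beta>, \<gamma>). \<alpha>)" "group_hom \<B> (BijGroup Q) (\<lambda>(\<alpha>, \<beta>, \<gamma>). \<beta>)"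
    "group_hom \<B> (BijGroup Q) (\<lambda>(\<alpha>, \<beta>, \<gamma>). \<gamma>)"
    by (auto simp: group_hom_def group_hom_axioms_def group_triples group_BijGroup hom_def)
  then show "subgroup (comp1 N) (BijGroup Q)" "subgroup (comp2 N) (BijGroup Q)"
    "subgroup (comp3 N) (BijGroup Q)"
    using assms unfolding comp1_def comp2_def comp3_def
    by (auto intro: group_hom.subgroup_img_is_subgroup)
qed

end

end

theory Submission
  imports Defs
begin

text \<open>An autotopy in \<open>NA_r\<close> amounts to a pair \<open>(\<beta>, \<gamma>)\<close> with \<open>x \<cdot> \<beta> y = \<gamma> (x \<cdot> y)\<close>, that is,
  \<open>L\<^sub>x \<beta> = \<gamma> L\<^sub>x\<close> for every left translation \<open>L\<^sub>x\<close>. In any quasigroup, \<open>\<beta>\<close> therefore moves \<open>x\<close> to \<open>y\<close>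
  if and only if \<open>\<gamma>\<close> moves \<open>z \<cdot> x\<close> to \<open>z \<cdot> y\<close>, so left translations carry \<open>Theta2_r\<close> onto
  \<open>Theta3_r\<close> (\<open>Theta2_r_iff_Theta3_r\<close>). In an LIP-quasigroup the inverse of a left translation
  is again a left translation, and \<open>L\<^sub>x \<beta> = \<gamma> L\<^sub>x\<close> turns into \<open>L\<^sub>x \<gamma> = \<beta> L\<^sub>x\<close>: the second and
  third components of \<open>NA_r\<close> can be exchanged (\<open>comp2_NA_r_eq_comp3_NA_r\<close>). The two
  equivalences hence coincide, and the translation property says that they are normal from the left.

  The statement for RIP-quasigroups is the one for LIP-quasigroups read in the opposite
  quasigroup. A TS-quasigroup has both inverse properties; it equals its own opposite, which
  identifies \<open>NA_l\<close> with \<open>NA_r\<close>, and \<open>x \<cdot> (x \<cdot> y) = y\<close> makes \<open>(\<alpha>, \<beta>, \<epsilon>)\<close> an autotopy exactly when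
  \<open>(\<alpha>, \<epsilon>, \<beta>)\<close> is one, which identifies the component groups of \<open>NA_m\<close> with those of \<open>NA_l\<close>.\<close>

section \<open>Orbits and left translations\<close>

lemma orbit_rel_iff:
  assumes "subgroup H (BijGroup Q)"
  shows "(x, y) \<in> orbit_rel Q H \<longleftrightarrow> x \<in> Q \<and> (\<exists>\<sigma>\<in>H. \<sigma> x = y)"
proof -
  let ?G = "(BijGroup Q)\<lparr>carrier := H\<rparr>" and ?\<phi> = "\<lambda>\<sigma>::'a \<Rightarrow> 'a. \<sigma>"
  interpret A: group_action ?G Q ?\<phi>
    by (rule group_action_BijGroup_subgroup[OF assms])
  have orb: "orbit ?G ?\<phi> x = {\<sigma> x |\<sigma>. \<sigma> \<in> H}" for x
    by (simp add: orbit_def)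
  show ?thesis
  proof
    assume "(x, y) \<in> orbit_rel Q H"
    then obtain B where B: "B \<in> orbits ?G Q ?\<phi>" "x \<in> B" "y \<in> B"
      by (auto simp: orbit_rel_def)
    then have x: "x \<in> Q" using A.orbits_coverture by blast
    then have "orbit ?G ?\<phi> x \<in> orbits ?G Q ?\<phi>" "x \<in> orbit ?G ?\<phi> x"
      using A.orbit_refl by (auto simp: orbits_def)
    then have "B = orbit ?G ?\<phi> x" using A.disjoint_union B by blast
    then show "x \<in> Q \<and> (\<exists>\<sigma>\<in>H. \<sigma> x = y)" using B x orb by auto
  next
    assume "x \<in> Q \<and> (\<exists>\<sigma>\<in>H. \<sigma> x = y)"
    then have "orbit ?G ?\<phi> x \<in> orbits ?G Q ?\<phi>" "x \<in> orbit ?G ?\<phi> x" "y \<in> orbit ?G ?\<phi> x"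
      using A.orbit_refl orb by (auto simp: orbits_def)
    then show "(x, y) \<in> orbit_rel Q H" by (auto simp: orbit_rel_def)
  qed
qed

context quasigroup
begin

lemma left_cancel:
  assumes "a \<in> Q" "x \<in> Q" "y \<in> Q" "a \<cdot> x = a \<cdot> y"
  shows "x = y"
  using right_div[OF assms(1) closed[OF assms(1,2)]] assms by auto

lemma mem_NA_l_iff:
  "(\<alpha>, \<beta>, \<gamma>) \<in> NA_l Q f \<longleftrightarrow> \<beta> = (\<lambda>x\<in>Q. x) \<and> \<alpha> \<in> Bij Q \<and> \<gamma> \<in> Bij Q \<and>
    (\<forall>x\<in>Q. \<forall>y\<in>Q. \<alpha> x \<cdot> y = \<gamma> (x \<cdot> y))"
  by (auto simp: NA_l_def autotopies_def BijGroup_simps id_Bij)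

lemma mem_NA_r_iff:
  "(\<alpha>, \<beta>, \<gamma>) \<in> NA_r Q f \<longleftrightarrow> \<alpha> = (\<lambda>x\<in>Q. x) \<and> \<beta> \<in> Bij Q \<and> \<gamma> \<in> Bij Q \<and>
    (\<forall>x\<in>Q. \<forall>y\<in>Q. x \<cdot> \<beta> y = \<gamma> (x \<cdot> y))"
  by (auto simp: NA_r_def autotopies_def BijGroup_simps id_Bij)

lemma mem_NA_m_iff:
  "(\<alpha>, \<beta>, \<gamma>) \<in> NA_m Q f \<longleftrightarrow> \<gamma> = (\<lambda>x\<in>Q. x) \<and> \<alpha> \<in> Bij Q \<and> \<beta> \<in> Bij Q \<and>
    (\<forall>x\<in>Q. \<forall>y\<in>Q. \<alpha> x \<cdot> \<beta> y = x \<cdot> y)"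
  by (auto simp: NA_m_def autotopies_def BijGroup_simps id_Bij closed)

lemma equiv_Theta2_r: "equiv Q (Theta2_r Q f)"
  unfolding Theta2_r_def
  by (intro equiv_orbit_rel subgroup_comp2 subgroup_NA_r)

lemma Theta2_r_iff:
  "(x, y) \<in> Theta2_r Q f \<longleftrightarrow> x \<in> Q \<and> (\<exists>\<alpha> \<beta> \<gamma>. (\<alpha>, \<beta>, \<gamma>) \<in> NA_r Q f \<and> \<beta> x = y)"
  unfolding Theta2_r_def orbit_rel_iff[OF subgroup_comp2[OF subgroup_NA_r]]
  by (force simp: comp2_def)

lemma Theta3_r_iff:
  "(x, y) \<in> Theta3_r Q f \<longleftrightarrow> x \<in> Q \<and> (\<exists>\<alpha> \<beta> \<gamma>. (\<alpha>, \<beta>, \<gamma>) \<in> NA_r Q f \<and> \<gamma> x = y)"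
  unfolding Theta3_r_def orbit_rel_iff[OF subgroup_comp3[OF subgroup_NA_r]]
  by (force simp: comp3_def)

lemma Theta2_r_iff_Theta3_r:
  assumes "x \<in> Q" "y \<in> Q" "z \<in> Q"
  shows "(x, y) \<in> Theta2_r Q f \<longleftrightarrow> (z \<cdot> x, z \<cdot> y) \<in> Theta3_r Q f"
proof -
  have "\<beta> x = y \<longleftrightarrow> \<gamma> (z \<cdot> x) = z \<cdot> y" if "(\<alpha>, \<beta>, \<gamma>) \<in> NA_r Q f" for \<alpha> \<beta> \<gamma>
  proof -
    have "\<beta> x \<in> Q" and "z \<cdot> \<beta> x = \<gamma> (z \<cdot> x)"
      using that assms Bij_imp_funcset[of \<beta> Q] by (auto simp: mem_NA_r_iff)
    then show ?thesis using left_cancel assms by metis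
  qed
  then show ?thesis
    using assms closed unfolding Theta2_r_iff Theta3_r_iff by blast
qed

end

section \<open>Left inverse property\<close>

context LIP_quasigroup
begin

text \<open>The permutation \<open>\<lambda>\<close> is onto \<open>Q\<close>, so it suffices to check \<open>z \<cdot> \<gamma> y = \<beta> (z \<cdot> y)\<close> for \<open>z = \<lambda> u\<close>; there
  both sides are rewritten with \<open>y = u \<cdot> v\<close>.\<close>

lemma NA_r_swap:
  assumes "(\<alpha>, \<beta>, \<gamma>) \<in> NA_r Q f"
  shows "(\<alpha>, \<gamma>, \<beta>) \<in> NA_r Q f"
proof -
  have a: "\<alpha> = (\<lambda>x\<in>Q. x)" "\<beta> \<in> Bij Q" "\<gamma> \<in> Bij Q"
    and atp: "\<And>x y. \<lbrakk>x \<in> Q; y \<in> Q\<rbrakk> \<Longrightarrow> x \<cdot> \<beta> y = \<gamma> (x \<cdot> y)"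
    using assms by (auto simp: mem_NA_r_iff)
  obtain lam where lam: "lam \<in> Bij Q" "\<And>x y. \<lbrakk>x \<in> Q; y \<in> Q\<rbrakk> \<Longrightarrow> lam x \<cdot> (x \<cdot> y) = y"
    using LIP by blast
  have "z \<cdot> \<gamma> y = \<beta> (z \<cdot> y)" if zy: "z \<in> Q" "y \<in> Q" for z y
  proof -
    obtain u where u: "u \<in> Q" "z = lam u"
      using zy lam(1) unfolding Bij_def bij_betw_def by blast
    obtain v where v: "v \<in> Q" "y = u \<cdot> v"
      using right_div[OF u(1) zy(2)] by auto
    have bv: "\<beta> v \<in> Q" using a v Bij_imp_funcset[of \<beta> Q] by auto
    have "z \<cdot> \<gamma> y = lam u \<cdot> (u \<cdot> \<beta> v)" using u v atp by simp
    also have "\<dots> = \<beta> v" using lam u bv by simp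
    also have "\<dots> = \<beta> (z \<cdot> y)" using lam u v by simp
    finally show ?thesis .
  qed
  then show ?thesis using a by (auto simp: mem_NA_r_iff)
qed

lemma comp2_NA_r_eq_comp3_NA_r: "comp2 (NA_r Q f) = comp3 (NA_r Q f)"
  using NA_r_swap by (force simp: comp2_def comp3_def)

lemma Theta2_r_eq_Theta3_r: "Theta2_r Q f = Theta3_r Q f"
  by (simp add: Theta2_r_def Theta3_r_def comp2_NA_r_eq_comp3_NA_r)

lemma normal_from_left_Theta2_r: "normal_from_left Q f (Theta2_r Q f)"
  using equiv_Theta2_r Theta2_r_iff_Theta3_r Theta2_r_eq_Theta3_r
  by (simp add: normal_from_left_def)

end

section \<open>Right inverse property\<close>

lemma NA_r_opposite: "NA_r Q (\<lambda>x y. f y x) = (\<lambda>(\<alpha>, \<beta>, \<gamma>). (\<beta>, \<alpha>, \<gamma>)) ` NA_l Q f"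
proof -
  have "(\<alpha>, \<beta>, \<gamma>) \<in> NA_r Q (\<lambda>x y. f y x) \<longleftrightarrow> (\<beta>, \<alpha>, \<gamma>) \<in> NA_l Q f" for \<alpha> \<beta> \<gamma>
    by (auto simp: NA_r_def NA_l_def autotopies_def)
  then show ?thesis by force
qed

lemma Theta2_r_opposite: "Theta2_r Q (\<lambda>x y. f y x) = Theta1_l Q f"
  by (simp add: Theta2_r_def Theta1_l_def comp1_def comp2_def NA_r_opposite image_image
      case_prod_unfold)

lemma Theta3_r_opposite: "Theta3_r Q (\<lambda>x y. f y x) = Theta3_l Q f"
  by (simp add: Theta3_r_def Theta3_l_def comp3_def NA_r_opposite image_image case_prod_unfold)

lemma normal_from_left_opposite:
  "normal_from_left Q (\<lambda>x y. f y x) \<theta> = normal_from_right Q f \<theta>"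
  by (simp add: normal_from_left_def normal_from_right_def)

context RIP_quasigroup
begin

lemma LIP_quasigroup_opposite: "LIP_quasigroup Q (\<lambda>x y. y \<cdot> x)"
proof
  show "\<exists>lam\<in>Bij Q. \<forall>x\<in>Q. \<forall>y\<in>Q. y \<cdot> x \<cdot> lam x = y"
    using RIP by blast
qed (simp_all add: nonempty closed left_div right_div)

lemma Theta1_l_eq_Theta3_l: "Theta1_l Q f = Theta3_l Q f"
  using LIP_quasigroup.Theta2_r_eq_Theta3_r[OF LIP_quasigroup_opposite]
  by (simp add: Theta2_r_opposite Theta3_r_opposite)

lemma normal_from_right_Theta1_l: "normal_from_right Q f (Theta1_l Q f)"
  using LIP_quasigroup.normal_from_left_Theta2_r[OF LIP_quasigroup_opposite]
  by (simp add: Theta2_r_opposite normal_from_left_opposite)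

end

section \<open>Totally symmetric quasigroups\<close>

context TS_quasigroup
begin

sublocale LIP_quasigroup
proof
  show "\<exists>lam\<in>Bij Q. \<forall>x\<in>Q. \<forall>y\<in>Q. lam x \<cdot> (x \<cdot> y) = y"
    by (rule bexI[OF _ id_Bij]) (simp add: TS)
qed

sublocale RIP_quasigroup
proof
  have "(x \<cdot> y) \<cdot> y = x" if "x \<in> Q" "y \<in> Q" for x y
    using that comm TS closed by metis
  then show "\<exists>rho\<in>Bij Q. \<forall>x\<in>Q. \<forall>y\<in>Q. x \<cdot> y \<cdot> rho y = x"
    by (intro bexI[OF _ id_Bij]) simp
qed

lemma Theta1_l_eq_Theta2_r: "Theta1_l Q f = Theta2_r Q f"
proof -
  have "autotopies Q (\<lambda>x y. y \<cdot> x) = autotopies Q f"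
  proof -
    have "(\<beta> y) \<cdot> (\<alpha> x) = (\<alpha> x) \<cdot> (\<beta> y)"
      if "\<alpha> \<in> Bij Q" "\<beta> \<in> Bij Q" "x \<in> Q" "y \<in> Q" for \<alpha> \<beta> x y
      using that Bij_imp_funcset by (intro comm) blast+
    then show ?thesis unfolding autotopies_def by (auto simp: comm)
  qed
  then have "Theta2_r Q (\<lambda>x y. y \<cdot> x) = Theta2_r Q f"
    by (simp add: Theta2_r_def NA_r_def)
  then show ?thesis by (simp add: Theta2_r_opposite)
qed

lemma NA_m_eq: "NA_m Q f = (\<lambda>(\<alpha>, \<beta>, \<gamma>). (\<alpha>, \<gamma>, \<beta>)) ` NA_l Q f"
proof -
  have "(\<alpha>, \<beta>, \<gamma>) \<in> NA_m Q f \<longleftrightarrow> (\<alpha>, \<gamma>, \<beta>) \<in> NA_l Q f" for \<alpha> \<beta> \<gamma>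
  proof -
    have "(\<forall>x\<in>Q. \<forall>y\<in>Q. \<alpha> x \<cdot> \<beta> y = x \<cdot> y) \<longleftrightarrow> (\<forall>x\<in>Q. \<forall>y\<in>Q. \<alpha> x \<cdot> y = \<beta> (x \<cdot> y))"
      if "\<alpha> \<in> Bij Q" "\<beta> \<in> Bij Q"
    proof -
      have mem: "\<alpha> x \<in> Q" "\<beta> x \<in> Q" if "x \<in> Q" for x
        using \<open>\<alpha> \<in> Bij Q\<close> \<open>\<beta> \<in> Bij Q\<close> that Bij_imp_funcset by blast+
      \<comment> \<open>In both directions, substitute \<open>x \<cdot> y\<close> for \<open>y\<close> and then multiply by \<open>\<alpha> x\<close> on the left.\<close>
      show ?thesis
      proof (intro iffI ballI)
        fix x y assume *: "\<forall>x\<in>Q. \<forall>y\<in>Q. \<alpha> x \<cdot> \<beta> y = x \<cdot> y" and xy: "x \<in> Q" "y \<in> Q"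
        then have "\<alpha> x \<cdot> \<beta> (x \<cdot> y) = y" by (simp add: closed TS)
        then show "\<alpha> x \<cdot> y = \<beta> (x \<cdot> y)" using TS mem xy closed by metis
      next
        fix x y assume *: "\<forall>x\<in>Q. \<forall>y\<in>Q. \<alpha> x \<cdot> y = \<beta> (x \<cdot> y)" and xy: "x \<in> Q" "y \<in> Q"
        then have "\<alpha> x \<cdot> (x \<cdot> y) = \<beta> y" by (simp add: closed TS)
        then show "\<alpha> x \<cdot> \<beta> y = x \<cdot> y" using TS mem xy closed by metis
      qed
    qed
    then show ?thesis by (auto simp: mem_NA_m_iff mem_NA_l_iff)
  qed
  then show ?thesis by force
qed

lemma Theta1_m_eq_Theta1_l: "Theta1_m Q f = Theta1_l Q f"
  by (simp add: Theta1_m_def Theta1_l_def comp1_def NA_m_eq image_image case_prod_unfold)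

lemma Theta2_m_eq_Theta3_l: "Theta2_m Q f = Theta3_l Q f"
  by (simp add: Theta2_m_def Theta3_l_def comp2_def comp3_def NA_m_eq image_image
      case_prod_unfold)

lemma normal_congruence_Theta1_l: "normal_congruence Q f (Theta1_l Q f)"
  using normal_from_left_Theta2_r normal_from_right_Theta1_l
  by (simp add: normal_congruence_def Theta1_l_eq_Theta2_r)

end

section \<open>Equality and normality of the orbit equivalences\<close>

theorem theorem4p45:
  fixes Q :: "'a set" and f :: "'a \<Rightarrow> 'a \<Rightarrow> 'a"
  assumes "quasigroup Q f"
  shows "(LIP_quasigroup Q f \<longrightarrow>
            Theta2_r Q f = Theta3_r Q f \<and>
            (\<forall>\<theta> \<in> {Theta2_r Q f, Theta3_r Q f}. normal_from_left Q f \<theta>)) \<and>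
         (RIP_quasigroup Q f \<longrightarrow>
            Theta1_l Q f = Theta3_l Q f \<and>
            (\<forall>\<theta> \<in> {Theta1_l Q f, Theta3_l Q f}. normal_from_right Q f \<theta>)) \<and>
         (TS_quasigroup Q f \<longrightarrow>
            Theta1_l Q f = Theta3_l Q f \<and>
            Theta3_l Q f = Theta2_r Q f \<and>
            Theta2_r Q f = Theta3_r Q f \<and>
            Theta3_r Q f = Theta1_m Q f \<and>
            Theta1_m Q f = Theta2_m Q f \<and>
            (\<forall>\<theta> \<in> {Theta1_l Q f, Theta3_l Q f, Theta2_r Q f, Theta3_r Q f, Theta1_m Q f, Theta2_m Q f}.
               normal_congruence Q f \<theta>))"
proof (intro conjI impI)
  assume "LIP_quasigroup Q f"
  then interpret LIP_quasigroup Q f .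
  show "Theta2_r Q f = Theta3_r Q f" by (rule Theta2_r_eq_Theta3_r)
  then show "\<forall>\<theta> \<in> {Theta2_r Q f, Theta3_r Q f}. normal_from_left Q f \<theta>"
    using normal_from_left_Theta2_r by simp
next
  assume "RIP_quasigroup Q f"
  then interpret RIP_quasigroup Q f .
  show "Theta1_l Q f = Theta3_l Q f" by (rule Theta1_l_eq_Theta3_l)
  then show "\<forall>\<theta> \<in> {Theta1_l Q f, Theta3_l Q f}. normal_from_right Q f \<theta>"
    using normal_from_right_Theta1_l by simp
next
  assume "TS_quasigroup Q f"
  then interpret TS_quasigroup Q f .
  note eqs = Theta1_l_eq_Theta3_l Theta1_l_eq_Theta2_r Theta2_r_eq_Theta3_r
    Theta1_m_eq_Theta1_l Theta2_m_eq_Theta3_l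
  show "Theta1_l Q f = Theta3_l Q f" "Theta3_l Q f = Theta2_r Q f"
    "Theta2_r Q f = Theta3_r Q f" "Theta3_r Q f = Theta1_m Q f" "Theta1_m Q f = Theta2_m Q f"
    using eqs by simp_all
  then show "\<forall>\<theta> \<in> {Theta1_l Q f, Theta3_l Q f, Theta2_r Q f, Theta3_r Q f, Theta1_m Q f,
      Theta2_m Q f}. normal_congruence Q f \<theta>"
    using normal_congruence_Theta1_l by simp
qed

end
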